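(* Let $k>1$ be a fixed integer and let $X$ be a quandle that satisfies the identity $S$: $x\,Y^k=x$ for all $x,y_1,y_2\in X$, where $z\,Y^i$ denotes the left-associated product of $z$ followed by the sequence $y_1,y_2$ repeated $i$ times. Then the following hold. (i) For all $x,y_1,y_2\in X$, the $2$-chain $$L_S=L_S(x,y_1,y_2)=\sum_{i=0}^{k-1}\bigl[(x\,Y^i,\,y_1)+(x\,Y^i y_1,\,y_2)\bigr]\in C_2(X)$$ is a rack $2$-cycle, i.e. $\partial_2(L_S)=0$. (ii) For every abelian group $A$ and every rack $2$-cocycle $\phi:X\times X\to A$, the abelian extension $E(X,A,\phi)$ satisfies $S$ if and only if $\phi(L_S(x,y_1,y_2))=0$ for all $x,y_1,y_2\in X$. (iii) For each $n$, let $C^S_n(X)$ be the subgroup of $C_n(X)$ generated by all elements $$\sum_{i=0}^{k-1}\bigl[(x_1Y^i,\dots,x_jY^i,\,y_1,\,x_{j+2},\dots,x_n)+(x_1Y^iy_1,\dots,x_jY^iy_1,\,y_2,\,x_{j+2},\dots,x_n)\bigr],$$ where $0\le j\le n-1$, $y_1,y_2\in X$, and $x_h\in X$ for $h\in\{1,\dots,n\}\setminus\{j+1\}$. Then $\{C^S_n(X),\partial_n\}$ is a subcomplex of $\{C_n(X),\partial_n\}$, i.e. $\partial_n(C_n^S(X))\subset C_{n-1}^S(X)$ for all $n$.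
   Context: A rack is a non-empty set $X$ with a binary operation $*$ such that (1) for every $b\in X$ the map $R_b:X\to X$, $R_b(a)=a*b$, is a bijection, and (2) $(a*b)*c=(a*c)*(b*c)$ for all $a,b,c\in X$. A quandle is a rack with $a*a=a$ for all $a$. Products are written without $*$ and are left-associated: $x_1x_2\cdots x_k=(\cdots((x_1*x_2)*x_3)\cdots)*x_k$. Thus $z\,Y^0=z$, $z\,Y^{i+1}=((z\,Y^i)*y_1)*y_2$, and $z\,Y^iy_1=(z\,Y^i)*y_1$. A rack satisfies $S$ if $x\,Y^k=x$ for all of its elements $x,y_1,y_2$. Rack chain complex: for $n\ge1$, $C_n(X)$ is the free abelian group on $n$-tuples $(x_1,\dots,x_n)\in X^n$, and $C_n(X)=0$ for $n\le0$. The boundary is $\partial_n=\sum_{h=2}^n(-1)^h[d_h^{(n)}-\delta_h^{(n)}]$, where $d_h^{(n)}(x_1,\dots,x_n)=(x_1,\dots,\widehat{x_h},\dots,x_n)$ and $\delta_h^{(n)}(x_1,\dots,x_n)=(x_1*x_h,\dots,x_{h-1}*x_h,\widehat{x_h},x_{h+1},\dots,x_n)$ (hat means the entry is deleted). A rack $2$-cocycle with values in an abelian group $A$ is a function $\phi:X\times X\to A$ with $\phi(x,y)-\phi(x,z)+\phi(x*y,z)-\phi(x*z,y*z)=0$ for all $x,y,z\in X$; it is extended linearly to $C_2(X)$. The abelian extension $E(X,A,\phi)$ is the rack $X\times A$ with operation $(x,a)*(y,b)=(x*y,\,a+\phi(x,y))$. *)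

theory Defs
  imports "HOL-Algebra.Free_Abelian_Groups" "HOL-Algebra.Generated_Groups"
begin

section \<open>Racks and quandles\<close>

record 'a rack_struct = "'a partial_object" +
  rop :: "['a, 'a] \<Rightarrow> 'a"  (infixl "\<triangleright>\<index>" 70)

locale rack =
  fixes X (structure)
  assumes nonempty: "carrier X \<noteq> {}"
    and bij_right: "b \<in> carrier X \<Longrightarrow> bij_betw (\<lambda>a. a \<triangleright> b) (carrier X) (carrier X)"
    and self_distrib: "\<lbrakk>a \<in> carrier X; b \<in> carrier X; c \<in> carrier X\<rbrakk>
      \<Longrightarrow> (a \<triangleright> b) \<triangleright> c = (a \<triangleright> c) \<triangleright> (b \<triangleright> c)"

locale quandle = rack +
  assumes idem: "a \<in> carrier X \<Longrightarrow> a \<triangleright> a = a"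

text \<open>\<open>Ypow X y1 y2 z i\<close> is $z\,Y^i$.\<close>

primrec Ypow :: "('a, 'r) rack_struct_scheme \<Rightarrow> 'a \<Rightarrow> 'a \<Rightarrow> 'a \<Rightarrow> nat \<Rightarrow> 'a" where
  "Ypow X y1 y2 z 0 = z"
| "Ypow X y1 y2 z (Suc i) = (Ypow X y1 y2 z i \<triangleright>\<^bsub>X\<^esub> y1) \<triangleright>\<^bsub>X\<^esub> y2"

definition satisfies_S :: "nat \<Rightarrow> ('a, 'r) rack_struct_scheme \<Rightarrow> bool" where
  "satisfies_S k X \<longleftrightarrow>
    (\<forall>x\<in>carrier X. \<forall>y1\<in>carrier X. \<forall>y2\<in>carrier X. Ypow X y1 y2 x k = x)"

section \<open>The rack chain complex\<close>

text \<open>An \<open>n\<close>-tuple is a list of length \<open>n\<close>. Degrees are integers: for \<open>n \<le> 0\<close> there are no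
  basis elements (not even the empty tuple), so the chain group is trivial.\<close>

definition tuples :: "('a, 'r) rack_struct_scheme \<Rightarrow> int \<Rightarrow> 'a list set" where
  "tuples X n = {xs. n \<ge> 1 \<and> int (length xs) = n \<and> set xs \<subseteq> carrier X}"

definition chain_group :: "('a, 'r) rack_struct_scheme \<Rightarrow> int \<Rightarrow> ('a list \<Rightarrow>\<^sub>0 int) monoid" where
  "chain_group X n = free_Abelian_group (tuples X n)"

text \<open>Positions \<open>h\<close> are counted from 1, so the entry $x_h$ of \<open>xs\<close> is \<open>xs ! (h - 1)\<close>.\<close>

definition face_d :: "nat \<Rightarrow> 'a list \<Rightarrow> 'a list" where
  "face_d h xs = take (h - 1) xs @ drop h xs"

definition face_delta :: "('a, 'r) rack_struct_scheme \<Rightarrow> nat \<Rightarrow> 'a list \<Rightarrow> 'a list" where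
  "face_delta X h xs = map (\<lambda>x. x \<triangleright>\<^bsub>X\<^esub> xs ! (h - 1)) (take (h - 1) xs) @ drop h xs"

definition boundary ::
    "('a, 'r) rack_struct_scheme \<Rightarrow> int \<Rightarrow> ('a list \<Rightarrow>\<^sub>0 int) \<Rightarrow> ('a list \<Rightarrow>\<^sub>0 int)" where
  "boundary X n = frag_extend (\<lambda>xs. \<Sum>h = 2..nat n.
     frag_cmul ((-1) ^ h) (frag_of (face_d h xs) - frag_of (face_delta X h xs)))"

definition rack_cycle :: "('a, 'r) rack_struct_scheme \<Rightarrow> int \<Rightarrow> ('a list \<Rightarrow>\<^sub>0 int) \<Rightarrow> bool" where
  "rack_cycle X n c \<longleftrightarrow> c \<in> carrier (chain_group X n) \<and> boundary X n c = 0"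

definition rack_subcomplex ::
    "('a, 'r) rack_struct_scheme \<Rightarrow> (int \<Rightarrow> ('a list \<Rightarrow>\<^sub>0 int) set) \<Rightarrow> bool" where
  "rack_subcomplex X D \<longleftrightarrow>
    (\<forall>n. subgroup (D n) (chain_group X n) \<and> boundary X n ` D n \<subseteq> D (n - 1))"

section \<open>Rack 2-cocycles and abelian extensions\<close>

text \<open>The coefficient group \<open>A\<close> is a \<open>comm_group\<close>, hence written multiplicatively.\<close>

definition rack_2cocycle ::
    "('a, 'r) rack_struct_scheme \<Rightarrow> ('b, 's) monoid_scheme \<Rightarrow> ('a \<Rightarrow> 'a \<Rightarrow> 'b) \<Rightarrow> bool" where
  "rack_2cocycle X A \<phi> \<longleftrightarrow>
    (\<forall>x\<in>carrier X. \<forall>y\<in>carrier X. \<phi> x y \<in> carrier A) \<and>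
    (\<forall>x\<in>carrier X. \<forall>y\<in>carrier X. \<forall>z\<in>carrier X.
      \<phi> x y \<otimes>\<^bsub>A\<^esub> inv\<^bsub>A\<^esub> (\<phi> x z) \<otimes>\<^bsub>A\<^esub> \<phi> (x \<triangleright>\<^bsub>X\<^esub> y) z
        \<otimes>\<^bsub>A\<^esub> inv\<^bsub>A\<^esub> (\<phi> (x \<triangleright>\<^bsub>X\<^esub> z) (y \<triangleright>\<^bsub>X\<^esub> z)) = \<one>\<^bsub>A\<^esub>)"

text \<open>The linear extension of \<open>\<phi>\<close> to 2-chains.\<close>

definition eval_2chain ::
    "('b, 's) monoid_scheme \<Rightarrow> ('a \<Rightarrow> 'a \<Rightarrow> 'b) \<Rightarrow> ('a list \<Rightarrow>\<^sub>0 int) \<Rightarrow> 'b" where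
  "eval_2chain A \<phi> c =
    (\<Otimes>\<^bsub>A\<^esub>s\<in>Poly_Mapping.keys c. \<phi> (s ! 0) (s ! 1) [^]\<^bsub>A\<^esub> (Poly_Mapping.lookup c s :: int))"

definition abelian_extension ::
    "('a, 'r) rack_struct_scheme \<Rightarrow> ('b, 's) monoid_scheme \<Rightarrow> ('a \<Rightarrow> 'a \<Rightarrow> 'b) \<Rightarrow> ('a \<times> 'b) rack_struct"
  where
  "abelian_extension X A \<phi> =
    \<lparr>carrier = carrier X \<times> carrier A,
     rop = (\<lambda>(x, a) (y, b). (x \<triangleright>\<^bsub>X\<^esub> y, a \<otimes>\<^bsub>A\<^esub> \<phi> x y))\<rparr>"

lemma rack_abelian_extension:
  fixes X :: "('a, 'r) rack_struct_scheme" and A :: "('b, 's) monoid_scheme"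
  assumes "rack X" and "comm_group A" and "rack_2cocycle X A \<phi>"
  shows "rack (abelian_extension X A \<phi>)"
proof -
  interpret X: rack X by fact
  interpret A: comm_group A by fact
  have cl: "x \<triangleright>\<^bsub>X\<^esub> y \<in> carrier X" if "x \<in> carrier X" "y \<in> carrier X" for x y
    using X.bij_right[OF that(2)] that(1) by (auto simp: bij_betw_def)
  have \<phi>: "\<phi> x y \<in> carrier A" if "x \<in> carrier X" "y \<in> carrier X" for x y
    using assms(3) that by (auto simp: rack_2cocycle_def)
  have coc: "\<phi> x y \<otimes>\<^bsub>A\<^esub> \<phi> (x \<triangleright>\<^bsub>X\<^esub> y) z = \<phi> x z \<otimes>\<^bsub>A\<^esub> \<phi> (x \<triangleright>\<^bsub>X\<^esub> z) (y \<triangleright>\<^bsub>X\<^esub> z)"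
    if xyz: "x \<in> carrier X" "y \<in> carrier X" "z \<in> carrier X" for x y z
  proof -
    define p q r s where "p = \<phi> x y" and "q = \<phi> x z" and "r = \<phi> (x \<triangleright>\<^bsub>X\<^esub> y) z"
      and "s = \<phi> (x \<triangleright>\<^bsub>X\<^esub> z) (y \<triangleright>\<^bsub>X\<^esub> z)"
    have c: "p \<in> carrier A" "q \<in> carrier A" "r \<in> carrier A" "s \<in> carrier A"
      using xyz by (simp_all add: p_def q_def r_def s_def \<phi> cl)
    have "p \<otimes>\<^bsub>A\<^esub> inv\<^bsub>A\<^esub> q \<otimes>\<^bsub>A\<^esub> r \<otimes>\<^bsub>A\<^esub> inv\<^bsub>A\<^esub> s = \<one>\<^bsub>A\<^esub>"
      using assms(3) xyz by (simp add: rack_2cocycle_def p_def q_def r_def s_def)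
    then have "p \<otimes>\<^bsub>A\<^esub> inv\<^bsub>A\<^esub> q \<otimes>\<^bsub>A\<^esub> r = s"
      using c A.inv_solve_right'[of "\<one>\<^bsub>A\<^esub>" "p \<otimes>\<^bsub>A\<^esub> inv\<^bsub>A\<^esub> q \<otimes>\<^bsub>A\<^esub> r" s] by simp
    moreover have "p \<otimes>\<^bsub>A\<^esub> inv\<^bsub>A\<^esub> q \<otimes>\<^bsub>A\<^esub> r = inv\<^bsub>A\<^esub> q \<otimes>\<^bsub>A\<^esub> (p \<otimes>\<^bsub>A\<^esub> r)"
      using c by (simp add: A.m_comm A.m_assoc A.m_lcomm)
    ultimately have "s = inv\<^bsub>A\<^esub> q \<otimes>\<^bsub>A\<^esub> (p \<otimes>\<^bsub>A\<^esub> r)"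
      by simp
    then have "p \<otimes>\<^bsub>A\<^esub> r = q \<otimes>\<^bsub>A\<^esub> s"
      using c by (simp add: A.m_assoc[symmetric])
    then show ?thesis
      by (simp add: p_def q_def r_def s_def)
  qed
  show ?thesis
  proof
    show "carrier (abelian_extension X A \<phi>) \<noteq> {}"
      using X.nonempty A.one_closed by (auto simp: abelian_extension_def)
  next
    fix b assume "b \<in> carrier (abelian_extension X A \<phi>)"
    then obtain y c where b: "b = (y, c)" "y \<in> carrier X"
      by (auto simp: abelian_extension_def)
    have inj: "inj_on (\<lambda>x. x \<triangleright>\<^bsub>X\<^esub> y) (carrier X)" and im: "(\<lambda>x. x \<triangleright>\<^bsub>X\<^esub> y) ` carrier X = carrier X"
      using X.bij_right[OF b(2)] by (auto simp: bij_betw_def)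
    show "bij_betw (\<lambda>a. a \<triangleright>\<^bsub>abelian_extension X A \<phi>\<^esub> b)
        (carrier (abelian_extension X A \<phi>)) (carrier (abelian_extension X A \<phi>))"
      unfolding bij_betw_def
    proof
      show "inj_on (\<lambda>a. a \<triangleright>\<^bsub>abelian_extension X A \<phi>\<^esub> b) (carrier (abelian_extension X A \<phi>))"
        by (rule inj_onI) (auto simp: abelian_extension_def b \<phi> dest: inj_onD[OF inj])
      show "(\<lambda>a. a \<triangleright>\<^bsub>abelian_extension X A \<phi>\<^esub> b) ` carrier (abelian_extension X A \<phi>)
          = carrier (abelian_extension X A \<phi>)"
      proof (intro equalityI subsetI)
        fix w assume "w \<in> (\<lambda>a. a \<triangleright>\<^bsub>abelian_extension X A \<phi>\<^esub> b) ` carrier (abelian_extension X A \<phi>)"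
        then show "w \<in> carrier (abelian_extension X A \<phi>)"
          using b by (auto simp: abelian_extension_def \<phi> cl)
      next
        fix w assume "w \<in> carrier (abelian_extension X A \<phi>)"
        then obtain u a where w: "w = (u, a)" "u \<in> carrier X" "a \<in> carrier A"
          by (auto simp: abelian_extension_def)
        with im obtain x where x: "x \<in> carrier X" "u = x \<triangleright>\<^bsub>X\<^esub> y" by blast
        have "w = (x, a \<otimes>\<^bsub>A\<^esub> inv\<^bsub>A\<^esub> \<phi> x y) \<triangleright>\<^bsub>abelian_extension X A \<phi>\<^esub> b"
          using w x b by (simp add: abelian_extension_def A.m_assoc \<phi>)
        moreover have "(x, a \<otimes>\<^bsub>A\<^esub> inv\<^bsub>A\<^esub> \<phi> x y) \<in> carrier (abelian_extension X A \<phi>)"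
          using w x b by (simp add: abelian_extension_def \<phi>)
        ultimately show "w \<in> (\<lambda>a. a \<triangleright>\<^bsub>abelian_extension X A \<phi>\<^esub> b) ` carrier (abelian_extension X A \<phi>)"
          by blast
      qed
    qed
  next
    fix a b c
    assume "a \<in> carrier (abelian_extension X A \<phi>)" "b \<in> carrier (abelian_extension X A \<phi>)"
      "c \<in> carrier (abelian_extension X A \<phi>)"
    then show "(a \<triangleright>\<^bsub>abelian_extension X A \<phi>\<^esub> b) \<triangleright>\<^bsub>abelian_extension X A \<phi>\<^esub> c
      = (a \<triangleright>\<^bsub>abelian_extension X A \<phi>\<^esub> c) \<triangleright>\<^bsub>abelian_extension X A \<phi>\<^esub> (b \<triangleright>\<^bsub>abelian_extension X A \<phi>\<^esub> c)"
      by (auto simp: abelian_extension_def A.m_assoc \<phi> cl intro: coc X.self_distrib)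
  qed
qed

section \<open>The chains associated with the identity S\<close>

definition L_S :: "nat \<Rightarrow> ('a, 'r) rack_struct_scheme \<Rightarrow> 'a \<Rightarrow> 'a \<Rightarrow> 'a \<Rightarrow> ('a list \<Rightarrow>\<^sub>0 int)" where
  "L_S k X x y1 y2 = (\<Sum>i<k.
     frag_of [Ypow X y1 y2 x i, y1] + frag_of [Ypow X y1 y2 x i \<triangleright>\<^bsub>X\<^esub> y1, y2])"

text \<open>\<open>xs\<close> is $(x_1,\dots,x_j)$ and \<open>zs\<close> is $(x_{j+2},\dots,x_n)$.\<close>

definition S_chain ::
    "nat \<Rightarrow> ('a, 'r) rack_struct_scheme \<Rightarrow> 'a list \<Rightarrow> 'a \<Rightarrow> 'a \<Rightarrow> 'a list \<Rightarrow> ('a list \<Rightarrow>\<^sub>0 int)" where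
  "S_chain k X xs y1 y2 zs = (\<Sum>i<k.
     frag_of (map (\<lambda>x. Ypow X y1 y2 x i) xs @ y1 # zs)
     + frag_of (map (\<lambda>x. Ypow X y1 y2 x i \<triangleright>\<^bsub>X\<^esub> y1) xs @ y2 # zs))"

text \<open>The condition on lengths says $0 \le j \le n-1$ for $j$ the length of \<open>xs\<close>.\<close>

definition S_chain_group ::
    "nat \<Rightarrow> ('a, 'r) rack_struct_scheme \<Rightarrow> int \<Rightarrow> ('a list \<Rightarrow>\<^sub>0 int) set" where
  "S_chain_group k X n = generate (chain_group X n)
     {S_chain k X xs y1 y2 zs | xs y1 y2 zs.
        int (length xs) + 1 + int (length zs) = n \<and>
        set xs \<subseteq> carrier X \<and> y1 \<in> carrier X \<and> y2 \<in> carrier X \<and> set zs \<subseteq> carrier X}"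

end

theory Submission
  imports Defs
begin

text \<open>
  Right translations are endomorphisms of the rack, hence so is \<open>z \<mapsto> z Y\<^sup>i\<close>. Consequently a face
  at a position other than \<open>j + 1\<close> sends a generator of \<open>C\<^sup>S\<close> to another generator, while at
  position \<open>j + 1\<close> the differences \<open>d - \<delta>\<close> telescope along
  \<open>x, x y\<^sub>1, x y\<^sub>1 y\<^sub>2, \<dots>, x Y\<^sup>k = x\<close>. The chain \<open>L\<^sub>S\<close> is the generator with \<open>j = 1\<close> and \<open>n = 2\<close>,
  where this position is the only one. In the abelian extension the second component
  of \<open>(x, a) Y\<^sup>k\<close> accumulates precisely the values of \<open>\<phi>\<close> on the summands of \<open>L\<^sub>S\<close>.
\<close>

section \<open>Faces of concatenated tuples\<close>

lemma face_d_map: "face_d h (map f xs) = map f (face_d h xs)"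
  by (simp add: face_d_def take_map drop_map)

lemma face_d_append_left: "1 \<le> h \<Longrightarrow> h \<le> length xs \<Longrightarrow> face_d h (xs @ ys) = face_d h xs @ ys"
  by (simp add: face_d_def)

lemma face_d_append_right: "length xs < h \<Longrightarrow> face_d h (xs @ ys) = xs @ face_d (h - length xs) ys"
  by (simp add: face_d_def)

lemma face_d_Cons: "2 \<le> h \<Longrightarrow> face_d h (y # ys) = y # face_d (h - 1) ys"
  by (cases h; cases "h - 1") (auto simp: face_d_def)

lemma face_d_Cons_1 [simp]: "face_d (Suc 0) (y # ys) = ys"
  by (simp add: face_d_def)

lemma length_face_d: "1 \<le> h \<Longrightarrow> h \<le> length xs \<Longrightarrow> length (face_d h xs) = length xs - 1"
  by (simp add: face_d_def)

lemma set_face_d_subset: "set xs \<subseteq> B \<Longrightarrow> set (face_d h xs) \<subseteq> B"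
  by (auto simp: face_d_def dest: in_set_takeD in_set_dropD)

lemma face_delta_append_left:
  "1 \<le> h \<Longrightarrow> h \<le> length xs \<Longrightarrow> face_delta X h (xs @ ys) = face_delta X h xs @ ys"
  by (simp add: face_delta_def nth_append)

text \<open>The acting entry lies in \<open>ys\<close>, so it multiplies all of \<open>xs\<close>;
  when it lies in \<open>xs\<close>, the whole of \<open>ys\<close> stays unchanged.\<close>

lemma face_delta_append_right:
  "length xs < h \<Longrightarrow>
    face_delta X h (xs @ ys) =
      map (\<lambda>x. x \<triangleright>\<^bsub>X\<^esub> ys ! (h - length xs - 1)) xs @ face_delta X (h - length xs) ys"
  by (auto simp: face_delta_def nth_append)

text \<open>Counted from 1, entry number \<open>h\<close> of \<open>y # ys\<close> is
  \<open>ys ! (h - 2)\<close>, and it acts on \<open>y\<close> as well.\<close>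

lemma face_delta_Cons:
  "2 \<le> h \<Longrightarrow> face_delta X h (y # ys) = (y \<triangleright>\<^bsub>X\<^esub> ys ! (h - 2)) # face_delta X (h - 1) ys"
  by (cases h; cases "h - 1") (auto simp: face_delta_def numeral_2_eq_2)

lemma face_delta_Cons_1 [simp]: "face_delta X (Suc 0) (y # ys) = ys"
  by (simp add: face_delta_def)

lemma length_face_delta: "1 \<le> h \<Longrightarrow> h \<le> length xs \<Longrightarrow> length (face_delta X h xs) = length xs - 1"
  by (simp add: face_delta_def)

section \<open>Iterated products in a rack\<close>

lemma Ypow_fixed:
  assumes "satisfies_S k X" "x \<in> carrier X" "y1 \<in> carrier X" "y2 \<in> carrier X"
  shows "Ypow X y1 y2 x k = x"
  using assms by (auto simp: satisfies_S_def)

context rack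
begin

lemma rop_closed [simp, intro]: "a \<in> carrier X \<Longrightarrow> b \<in> carrier X \<Longrightarrow> a \<triangleright> b \<in> carrier X"
  using bij_right[of b] by (auto simp: bij_betw_def)

lemma Ypow_closed [simp, intro]:
  "\<lbrakk>x \<in> carrier X; y1 \<in> carrier X; y2 \<in> carrier X\<rbrakk> \<Longrightarrow> Ypow X y1 y2 x i \<in> carrier X"
  by (induction i) auto

text \<open>Self-distributivity makes right translation by \<open>y1\<close> and by
  \<open>y2\<close> an endomorphism, and \<open>Ypow\<close> composes such translations. This serves
  the faces to the left of \<open>y1\<close>.\<close>

lemma Ypow_rop:
  assumes "a \<in> carrier X" "b \<in> carrier X" "y1 \<in> carrier X" "y2 \<in> carrier X"
  shows "Ypow X y1 y2 (a \<triangleright> b) i = Ypow X y1 y2 a i \<triangleright> Ypow X y1 y2 b i"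
  using assms by (induction i) (simp_all add: self_distrib[symmetric])

text \<open>Translation by \<open>z\<close> is an endomorphism, so it carries a product to the
  product of the translated letters. This serves the faces to the right of
  \<open>y1\<close>.\<close>

lemma Ypow_translate:
  assumes "x \<in> carrier X" "z \<in> carrier X" "y1 \<in> carrier X" "y2 \<in> carrier X"
  shows "Ypow X (y1 \<triangleright> z) (y2 \<triangleright> z) (x \<triangleright> z) i = Ypow X y1 y2 x i \<triangleright> z"
  using assms by (induction i) (simp_all add: self_distrib[symmetric])

lemma set_face_delta_subset:
  assumes "set xs \<subseteq> carrier X" "1 \<le> h" "h \<le> length xs"
  shows "set (face_delta X h xs) \<subseteq> carrier X"
proof -
  have "xs ! (h - 1) \<in> carrier X"
    using assms by (auto intro: subsetD nth_mem)
  then show ?thesis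
    using assms(1) by (auto simp: face_delta_def dest!: in_set_takeD in_set_dropD)
qed

lemma face_delta_map:
  assumes p: "\<And>a b. \<lbrakk>a \<in> carrier X; b \<in> carrier X\<rbrakk> \<Longrightarrow> p (a \<triangleright> b) = p a \<triangleright> p b"
    and xs: "set xs \<subseteq> carrier X" and h: "1 \<le> h" "h \<le> length xs"
  shows "face_delta X h (map p xs) = map p (face_delta X h xs)"
proof -
  have "xs ! (h - 1) \<in> carrier X"
    using xs h by (auto intro: subsetD nth_mem)
  moreover have "a \<in> carrier X" if "a \<in> set (take (h - 1) xs)" for a
    using that xs by (auto dest: in_set_takeD)
  ultimately show ?thesis
    using h by (auto simp: face_delta_def take_map drop_map p)
qed

end

section \<open>The subgroups generated by the chains of S\<close>

lemma group_chain_group: "group (chain_group X n)"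
  by (simp add: chain_group_def)

context rack
begin

lemma S_chain_in_carrier:
  assumes "set xs \<subseteq> carrier X" "y1 \<in> carrier X" "y2 \<in> carrier X" "set zs \<subseteq> carrier X"
    and "int (length xs) + 1 + int (length zs) = n"
  shows "S_chain k X xs y1 y2 zs \<in> carrier (chain_group X n)"
proof -
  have "frag_of (map (\<lambda>x. Ypow X y1 y2 x i) xs @ y1 # zs) \<in> carrier (chain_group X n)"
    and "frag_of (map (\<lambda>x. Ypow X y1 y2 x i \<triangleright> y1) xs @ y2 # zs) \<in> carrier (chain_group X n)" for i
    using assms by (auto simp: chain_group_def tuples_def)
  then show ?thesis
    unfolding S_chain_def chain_group_def
    by (intro sum_closed_free_Abelian_group) (auto simp del: keys_single dest!: subsetD[OF keys_add])
qed

lemma subgroup_S_chain_group: "subgroup (S_chain_group k X n) (chain_group X n)"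
  unfolding S_chain_group_def
  by (rule group.generate_is_subgroup[OF group_chain_group]) (auto intro: S_chain_in_carrier)

lemma S_chain_in_S_chain_group:
  assumes "set xs \<subseteq> carrier X" "y1 \<in> carrier X" "y2 \<in> carrier X" "set zs \<subseteq> carrier X"
    and "int (length xs) + 1 + int (length zs) = n"
  shows "S_chain k X xs y1 y2 zs \<in> S_chain_group k X n"
  unfolding S_chain_group_def using assms by (intro generate.incl) blast

section \<open>Closure properties in additive notation\<close>

lemma S_chain_group_0: "0 \<in> S_chain_group k X n"
  using subgroup.one_closed[OF subgroup_S_chain_group] by (simp add: chain_group_def)

lemma S_chain_group_add:
  "a \<in> S_chain_group k X n \<Longrightarrow> b \<in> S_chain_group k X n \<Longrightarrow> a + b \<in> S_chain_group k X n"
  \<comment> \<open>Membership in the carrier identifies the group inverse with negation.\<close>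
  using subgroup.m_closed[OF subgroup_S_chain_group] by (simp add: chain_group_def)

lemma S_chain_group_minus: "a \<in> S_chain_group k X n \<Longrightarrow> - a \<in> S_chain_group k X n"
  using subgroup.m_inv_closed[OF subgroup_S_chain_group, of a k n]
    subgroup.mem_carrier[OF subgroup_S_chain_group, of a k n]
  by (simp add: chain_group_def)

lemma S_chain_group_diff:
  "a \<in> S_chain_group k X n \<Longrightarrow> b \<in> S_chain_group k X n \<Longrightarrow> a - b \<in> S_chain_group k X n"
  using S_chain_group_add[OF _ S_chain_group_minus] by fastforce

lemma S_chain_group_frag_cmul:
  "a \<in> S_chain_group k X n \<Longrightarrow> frag_cmul c a \<in> S_chain_group k X n"
  by (rule frag_closure_minus_cmul) (auto intro: S_chain_group_0 S_chain_group_diff)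

lemma S_chain_group_sum:
  "(\<And>i. i \<in> I \<Longrightarrow> f i \<in> S_chain_group k X n) \<Longrightarrow> sum f I \<in> S_chain_group k X n"
  \<comment> \<open>Over an infinite index set \<open>sum\<close> is 0 by convention, and 0 is a
    member.\<close>
  by (induction I rule: infinite_finite_induct) (auto intro: S_chain_group_0 S_chain_group_add)

section \<open>Boundaries of the chains of S\<close>

text \<open>The unsigned contribution of one position to the boundary. The two faces are kept
  together because only their difference telescopes at position \<open>j + 1\<close>.\<close>

definition face_diff :: "nat \<Rightarrow> 'a list \<Rightarrow> ('a list \<Rightarrow>\<^sub>0 int)" where
  "face_diff h xs = frag_of (face_d h xs) - frag_of (face_delta X h xs)"

text \<open>Both sides are additive in \<open>c\<close> and agree on basis elements. With the sum
  over \<open>h\<close> outermost, each position can be treated separately.\<close>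

lemma boundary_eq_face_diff:
  "boundary X n c = (\<Sum>h = 2..nat n. frag_cmul ((-1) ^ h) (frag_extend (face_diff h) c))"
proof -
  have "c \<in> {c. boundary X n c =
      (\<Sum>h = 2..nat n. frag_cmul ((-1) ^ h) (frag_extend (face_diff h) c))}"
    using subset_UNIV
  proof (induction c rule: frag_induction)
    case (diff a b)
    have "frag_cmul s (u - v) = frag_cmul s u - frag_cmul s v" for s and u v :: "'a list \<Rightarrow>\<^sub>0 int"
      by (rule poly_mapping_eqI) (simp add: lookup_minus right_diff_distrib)
    with diff show ?case
      by (simp add: boundary_def frag_extend_diff sum_subtractf)
  qed (auto simp: boundary_def face_diff_def)
  then show ?thesis by simp
qed

lemma face_diff_S_chain:
  "frag_extend (face_diff h) (S_chain k X xs y1 y2 zs) =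
    (\<Sum>i<k. face_diff h (map (\<lambda>x. Ypow X y1 y2 x i) xs @ y1 # zs)
          + face_diff h (map (\<lambda>x. Ypow X y1 y2 x i \<triangleright> y1) xs @ y2 # zs))"
  by (simp add: S_chain_def frag_extend_sum frag_extend_add o_def)

text \<open>The maps applied to \<open>xs\<close> in each summand are endomorphisms and commute with
  both faces, while the entries from \<open>y1\<close> or \<open>y2\<close> onwards are
  untouched.\<close>

lemma face_diff_S_chain_left:
  assumes "set xs \<subseteq> carrier X" "y1 \<in> carrier X" "y2 \<in> carrier X"
    and h: "1 \<le> h" "h \<le> length xs"
  shows "frag_extend (face_diff h) (S_chain k X xs y1 y2 zs) =
    S_chain k X (face_d h xs) y1 y2 zs - S_chain k X (face_delta X h xs) y1 y2 zs"
proof -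
  have 1: "face_delta X h (map (\<lambda>x. Ypow X y1 y2 x i) xs) =
      map (\<lambda>x. Ypow X y1 y2 x i) (face_delta X h xs)" for i
    by (rule face_delta_map) (use assms in \<open>auto simp: Ypow_rop\<close>)
  have 2: "face_delta X h (map (\<lambda>x. Ypow X y1 y2 x i \<triangleright> y1) xs) =
      map (\<lambda>x. Ypow X y1 y2 x i \<triangleright> y1) (face_delta X h xs)" for i
    by (rule face_delta_map) (use assms in \<open>auto simp: Ypow_rop self_distrib[symmetric]\<close>)
  show ?thesis
    unfolding face_diff_S_chain unfolding S_chain_def sum_subtractf[symmetric]
    using h by (intro sum.cong)
      (simp_all add: face_diff_def face_d_append_left face_delta_append_left face_d_map 1 2)
qed

text \<open>Deleting \<open>y1\<close> or \<open>y2\<close> leaves a translate of \<open>xs\<close>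
  followed by \<open>zs\<close>. This is the one position where the boundary computation uses
  \<open>S\<close>.\<close>

lemma face_diff_S_chain_middle:
  assumes S: "satisfies_S k X"
    and xs: "set xs \<subseteq> carrier X" and y: "y1 \<in> carrier X" "y2 \<in> carrier X"
  shows "frag_extend (face_diff (Suc (length xs))) (S_chain k X xs y1 y2 zs) = 0"
proof -
  \<comment> \<open>Within one \<open>i\<close>, the delta face of the first tuple equals the d face
    of the second, so only \<open>f i - f (Suc i)\<close> survives.\<close>
  define f where "f i = frag_of (map (\<lambda>x. Ypow X y1 y2 x i) xs @ zs)" for i
  have "frag_extend (face_diff (Suc (length xs))) (S_chain k X xs y1 y2 zs) =
      (\<Sum>i<k. f i - f (Suc i))"
    unfolding face_diff_S_chain
    by (intro sum.cong)
      (simp_all add: face_diff_def f_def face_d_append_right face_delta_append_right o_def)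
  also have "\<dots> = f 0 - f k"
    by (rule sum_lessThan_telescope')
  also have "f k = f 0"
  proof -
    have "map (\<lambda>x. Ypow X y1 y2 x k) xs = xs"
      by (rule map_idI) (use xs y Ypow_fixed[OF S] in auto)
    then show ?thesis by (simp add: f_def)
  qed
  finally show ?thesis by simp
qed

text \<open>Here \<open>h\<close> counts within \<open>zs\<close>. The entry \<open>z\<close> acts
  on everything before it, including \<open>y1\<close> and \<open>y2\<close>, so the delta faces
  form the generator of the translated data.\<close>

lemma face_diff_S_chain_right:
  fixes xs zs :: "'a list" and h :: nat
  assumes xs: "set xs \<subseteq> carrier X" and y: "y1 \<in> carrier X" "y2 \<in> carrier X"
    and zs: "set zs \<subseteq> carrier X" and h: "1 \<le> h" "h \<le> length zs"
  defines "z \<equiv> zs ! (h - 1)"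
  shows "frag_extend (face_diff (length xs + 1 + h)) (S_chain k X xs y1 y2 zs) =
    S_chain k X xs y1 y2 (face_d h zs)
    - S_chain k X (map (\<lambda>x. x \<triangleright> z) xs) (y1 \<triangleright> z) (y2 \<triangleright> z) (face_delta X h zs)"
proof -
  have z: "z \<in> carrier X"
    using zs h by (auto simp: z_def intro: subsetD nth_mem)
  \<comment> \<open>A general \<open>p\<close> covers both kinds of summand at once.\<close>
  have 1: "face_diff (length xs + 1 + h) (map p xs @ y # zs) =
     frag_of (map p xs @ y # face_d h zs)
      - frag_of (map (\<lambda>x. p x \<triangleright> z) xs @ (y \<triangleright> z) # face_delta X h zs)" for p y
    using h by (simp add: face_diff_def face_d_append_right face_delta_append_right face_d_Cons
        face_delta_Cons z_def o_def nth_Cons')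
  have 2: "map (\<lambda>x. Ypow X y1 y2 x i \<triangleright> z) xs =
      map (\<lambda>x. Ypow X (y1 \<triangleright> z) (y2 \<triangleright> z) (x \<triangleright> z) i) xs" for i
    using xs y z by (auto simp: Ypow_translate)
  have 3: "map (\<lambda>x. Ypow X y1 y2 x i \<triangleright> y1 \<triangleright> z) xs =
      map (\<lambda>x. Ypow X (y1 \<triangleright> z) (y2 \<triangleright> z) (x \<triangleright> z) i \<triangleright> (y1 \<triangleright> z)) xs" for i
  proof (rule map_cong[OF refl])
    fix x assume "x \<in> set xs"
    with xs have x: "x \<in> carrier X" by auto
    have "Ypow X y1 y2 x i \<triangleright> y1 \<triangleright> z = (Ypow X y1 y2 x i \<triangleright> z) \<triangleright> (y1 \<triangleright> z)"
      using x y z by (intro self_distrib) auto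
    also have "Ypow X y1 y2 x i \<triangleright> z = Ypow X (y1 \<triangleright> z) (y2 \<triangleright> z) (x \<triangleright> z) i"
      using x y z by (intro Ypow_translate[symmetric]) auto
    finally show "Ypow X y1 y2 x i \<triangleright> y1 \<triangleright> z = Ypow X (y1 \<triangleright> z) (y2 \<triangleright> z) (x \<triangleright> z) i \<triangleright> (y1 \<triangleright> z)" .
  qed
  show ?thesis
    unfolding face_diff_S_chain unfolding S_chain_def sum_subtractf[symmetric] 1 2 3
    by (intro sum.cong) (simp_all add: o_def)
qed

lemma boundary_S_chain:
  assumes S: "satisfies_S k X"
    and xs: "set xs \<subseteq> carrier X" and y: "y1 \<in> carrier X" "y2 \<in> carrier X"
    and zs: "set zs \<subseteq> carrier X" and n: "int (length xs) + 1 + int (length zs) = n"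
  shows "boundary X n (S_chain k X xs y1 y2 zs) \<in> S_chain_group k X (n - 1)"
  unfolding boundary_eq_face_diff
proof (intro S_chain_group_sum S_chain_group_frag_cmul)
  \<comment> \<open>For \<open>n = 1\<close> the index range is empty and the boundary is 0.\<close>
  fix h assume "h \<in> {2..nat n}"
  then have h: "2 \<le> h" "h \<le> length xs + 1 + length zs"
    using n by auto
  \<comment> \<open>The deleted entry belongs to \<open>xs\<close>, is \<open>y1\<close> or
    \<open>y2\<close>, or belongs to \<open>zs\<close>.\<close>
  consider "h \<le> length xs" | "h = Suc (length xs)" | "length xs + 2 \<le> h"
    by linarith
  then show "frag_extend (face_diff h) (S_chain k X xs y1 y2 zs) \<in> S_chain_group k X (n - 1)"
  proof cases
    case 1
    then show ?thesis
      using h xs y zs n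
      by (subst face_diff_S_chain_left) (intro S_chain_group_diff S_chain_in_S_chain_group
          set_face_d_subset set_face_delta_subset | simp add: length_face_d length_face_delta)+
  next
    case 2
    then show ?thesis
      using face_diff_S_chain_middle[OF S xs y] by (simp add: S_chain_group_0)
  next
    case 3
    define g where "g = h - length xs - 1"
    have g: "h = length xs + 1 + g" "1 \<le> g" "g \<le> length zs"
      using 3 h by (auto simp: g_def)
    have "zs ! (g - 1) \<in> carrier X"
      using zs g by (auto intro: subsetD nth_mem)
    moreover from this have "set (map (\<lambda>x. x \<triangleright> zs ! (g - 1)) xs) \<subseteq> carrier X"
      using xs by auto
    ultimately show ?thesis
      unfolding g(1) face_diff_S_chain_right[OF xs y zs g(2,3)]
      using xs y zs n g
      by (intro S_chain_group_diff S_chain_in_S_chain_group set_face_d_subset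
          set_face_delta_subset rop_closed) (auto simp: length_face_d length_face_delta)
  qed
qed

text \<open>The boundary is additive, so the result for generators extends along the construction of
  the generated subgroup.\<close>

lemma boundary_S_chain_group:
  assumes "satisfies_S k X" "c \<in> S_chain_group k X n"
  shows "boundary X n c \<in> S_chain_group k X (n - 1)"
  using assms(2) unfolding S_chain_group_def[of k X n]
proof (induction rule: generate.induct)
  case one
  then show ?case by (simp add: chain_group_def boundary_def S_chain_group_0)
next
  case (incl c)
  then show ?case by (blast intro: boundary_S_chain[OF assms(1)])
next
  case (inv c)
  then have "c \<in> carrier (chain_group X n)"
    and "boundary X n c \<in> S_chain_group k X (n - 1)"
    by (blast intro: boundary_S_chain[OF assms(1)] S_chain_in_carrier)+
  then show ?case
    by (simp add: chain_group_def boundary_def frag_extend_minus S_chain_group_minus)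
next
  case (eng c d)
  then show ?case
    by (simp add: chain_group_def boundary_def frag_extend_add S_chain_group_add)
qed

section \<open>The 2-cycles \<open>L_S\<close>\<close>

lemma L_S_eq_S_chain: "L_S k X x y1 y2 = S_chain k X [x] y1 y2 []"
  by (simp add: L_S_def S_chain_def)

text \<open>In degree 2 the boundary has the single index 2, which is the telescoping position for
  \<open>xs = [x]\<close>.\<close>

lemma rack_cycle_L_S:
  assumes "satisfies_S k X" "x \<in> carrier X" "y1 \<in> carrier X" "y2 \<in> carrier X"
  shows "rack_cycle X 2 (L_S k X x y1 y2)"
  using assms face_diff_S_chain_middle[of k "[x]" y1 y2 "[]"]
  by (simp add: rack_cycle_def L_S_eq_S_chain S_chain_in_carrier boundary_eq_face_diff
      numeral_2_eq_2)

end

section \<open>Abelian extensions\<close>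

text \<open>The product in \<open>eval_2chain\<close> runs over a support that can shrink under
  addition, so both chains are first evaluated over a common finite set.\<close>

lemma hom_eval_2chain:
  assumes "comm_group A"
    and \<phi>: "\<And>x y. \<lbrakk>x \<in> carrier X; y \<in> carrier X\<rbrakk> \<Longrightarrow> \<phi> x y \<in> carrier A"
  shows "eval_2chain A \<phi> \<in> hom (chain_group X 2) A"
proof -
  interpret A: comm_group A by fact
  define f where "f c s = \<phi> (s ! 0) (s ! 1) [^]\<^bsub>A\<^esub> (Poly_Mapping.lookup c s :: int)" for c s
  have val: "\<phi> (s ! 0) (s ! 1) \<in> carrier A" if "s \<in> tuples X 2" for s
  proof -
    from that have "length s = 2" "set s \<subseteq> carrier X"
      by (auto simp: tuples_def)
    then show ?thesis
      by (intro \<phi>) (auto intro: subsetD nth_mem)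
  qed
  have f: "f c s \<in> carrier A" if "s \<in> tuples X 2" for c s
    using val[OF that] by (simp add: f_def)
  \<comment> \<open>Outside the support the exponent is 0 and the factor is one.\<close>
  have eval: "eval_2chain A \<phi> c = (\<Otimes>\<^bsub>A\<^esub>s\<in>K. f c s)"
    if "Poly_Mapping.keys c \<subseteq> K" "K \<subseteq> tuples X 2" "finite K" for c K
    unfolding eval_2chain_def f_def[symmetric]
    using that f by (intro A.finprod_mono_neutral_cong_left) (auto simp: f_def in_keys_iff)
  show ?thesis
  proof (rule homI)
    fix c assume "c \<in> carrier (chain_group X 2)"
    then have "Poly_Mapping.keys c \<subseteq> tuples X 2"
      by (simp add: chain_group_def)
    then show "eval_2chain A \<phi> c \<in> carrier A"
      using f by (subst eval[OF order_refl]) (auto intro!: A.finprod_closed)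
  next
    fix c d assume "c \<in> carrier (chain_group X 2)" "d \<in> carrier (chain_group X 2)"
    then have cd: "Poly_Mapping.keys c \<subseteq> tuples X 2" "Poly_Mapping.keys d \<subseteq> tuples X 2"
      by (simp_all add: chain_group_def)
    define K where "K = Poly_Mapping.keys c \<union> Poly_Mapping.keys d"
    have K: "K \<subseteq> tuples X 2" "finite K" "Poly_Mapping.keys c \<subseteq> K" "Poly_Mapping.keys d \<subseteq> K"
      "Poly_Mapping.keys (c + d) \<subseteq> K"
      using cd keys_add[of c d] by (auto simp: K_def)
    have "(\<Otimes>\<^bsub>A\<^esub>s\<in>K. f (c + d) s) = (\<Otimes>\<^bsub>A\<^esub>s\<in>K. f c s \<otimes>\<^bsub>A\<^esub> f d s)"
      using K f val by (intro A.finprod_cong) (auto simp: f_def lookup_add A.int_pow_mult simp_implies_def)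
    also have "\<dots> = (\<Otimes>\<^bsub>A\<^esub>s\<in>K. f c s) \<otimes>\<^bsub>A\<^esub> (\<Otimes>\<^bsub>A\<^esub>s\<in>K. f d s)"
      using K f by (intro A.finprod_multf) auto
    finally show "eval_2chain A \<phi> (c \<otimes>\<^bsub>chain_group X 2\<^esub> d) =
        eval_2chain A \<phi> c \<otimes>\<^bsub>A\<^esub> eval_2chain A \<phi> d"
      using K by (simp add: chain_group_def eval[of _ K])
  qed
qed

lemma (in comm_group) eval_2chain_frag_of:
  "\<phi> x y \<in> carrier G \<Longrightarrow> eval_2chain G \<phi> (frag_of [x, y]) = \<phi> x y"
  by (simp add: eval_2chain_def)

context rack
begin

text \<open>A right factor \<open>(y, b)\<close> changes the second component only by a value of
  \<open>\<phi>\<close> at \<open>y\<close>. Stating this for every length \<open>i\<close> lets the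
  partial sums of \<open>L_S\<close> accompany the induction.\<close>

lemma Ypow_abelian_extension:
  assumes "comm_group A" "rack_2cocycle X A \<phi>"
    and x: "x \<in> carrier X" "a \<in> carrier A" and y: "y1 \<in> carrier X" "y2 \<in> carrier X"
  shows "Ypow (abelian_extension X A \<phi>) (y1, b1) (y2, b2) (x, a) i =
    (Ypow X y1 y2 x i, a \<otimes>\<^bsub>A\<^esub> eval_2chain A \<phi> (L_S i X x y1 y2))"
proof -
  interpret A: comm_group A by fact
  have \<phi>: "\<phi> u v \<in> carrier A" if "u \<in> carrier X" "v \<in> carrier X" for u v
    using assms(2) that by (simp add: rack_2cocycle_def)
  have hom: "eval_2chain A \<phi> \<in> hom (chain_group X 2) A"
    by (rule hom_eval_2chain[OF assms(1) \<phi>])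
  interpret eval: group_hom "chain_group X 2" A "eval_2chain A \<phi>"
    by (intro group_hom.intro group_hom_axioms.intro group_chain_group A.is_group hom)
  have plus: "eval_2chain A \<phi> (c + d) = eval_2chain A \<phi> c \<otimes>\<^bsub>A\<^esub> eval_2chain A \<phi> d"
    if "c \<in> carrier (chain_group X 2)" "d \<in> carrier (chain_group X 2)" for c d
    using eval.hom_mult[OF that] by (simp add: chain_group_def)
  have pair: "frag_of [u, v] \<in> carrier (chain_group X 2)"
    if "u \<in> carrier X" "v \<in> carrier X" for u v
    using that by (simp add: chain_group_def tuples_def)
  have add_closed: "c + d \<in> carrier (chain_group X 2)"
    if "c \<in> carrier (chain_group X 2)" "d \<in> carrier (chain_group X 2)" for c d
    using eval.G.m_closed[OF that] by (simp add: chain_group_def)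
  show ?thesis
  proof (induction i)
    case 0
    show ?case
      using x by (simp add: L_S_def eval_2chain_def)
  next
    case (Suc i)
    let ?u = "Ypow X y1 y2 x i"
    have L: "L_S i X x y1 y2 \<in> carrier (chain_group X 2)"
      using x y by (simp add: L_S_eq_S_chain S_chain_in_carrier)
    have "L_S (Suc i) X x y1 y2 =
        L_S i X x y1 y2 + (frag_of [?u, y1] + frag_of [?u \<triangleright> y1, y2])"
      by (simp add: L_S_def)
    then have "eval_2chain A \<phi> (L_S (Suc i) X x y1 y2) =
        eval_2chain A \<phi> (L_S i X x y1 y2) \<otimes>\<^bsub>A\<^esub> (\<phi> ?u y1 \<otimes>\<^bsub>A\<^esub> \<phi> (?u \<triangleright> y1) y2)"
      using x y L by (simp add: plus pair add_closed A.eval_2chain_frag_of \<phi>)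
    then show ?case
      using x y L eval.hom_closed[OF L]
      by (simp add: Suc) (simp add: abelian_extension_def A.m_assoc \<phi>)
  qed
qed

text \<open>The first component returns to \<open>x\<close> because \<open>X\<close> satisfies
  \<open>S\<close>; cancelling \<open>a\<close> in the second leaves exactly the condition on
  \<open>L_S\<close>.\<close>

lemma satisfies_S_abelian_extension_iff:
  assumes "comm_group A" "rack_2cocycle X A \<phi>" "satisfies_S k X"
  shows "satisfies_S k (abelian_extension X A \<phi>) \<longleftrightarrow>
    (\<forall>x\<in>carrier X. \<forall>y1\<in>carrier X. \<forall>y2\<in>carrier X. eval_2chain A \<phi> (L_S k X x y1 y2) = \<one>\<^bsub>A\<^esub>)"
proof -
  interpret A: comm_group A by fact
  have carrier: "carrier (abelian_extension X A \<phi>) = carrier X \<times> carrier A"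
    by (simp add: abelian_extension_def)
  have L: "eval_2chain A \<phi> (L_S k X x y1 y2) \<in> carrier A"
    if "x \<in> carrier X" "y1 \<in> carrier X" "y2 \<in> carrier X" for x y1 y2
  proof -
    have "eval_2chain A \<phi> \<in> hom (chain_group X 2) A"
      using assms(2) by (intro hom_eval_2chain assms(1)) (simp add: rack_2cocycle_def)
    moreover have "L_S k X x y1 y2 \<in> carrier (chain_group X 2)"
      using that by (simp add: L_S_eq_S_chain S_chain_in_carrier)
    ultimately show ?thesis by (rule hom_in_carrier)
  qed
  have fixed_iff: "Ypow (abelian_extension X A \<phi>) (y1, b1) (y2, b2) (x, a) k = (x, a) \<longleftrightarrow>
      eval_2chain A \<phi> (L_S k X x y1 y2) = \<one>\<^bsub>A\<^esub>"
    if "x \<in> carrier X" "a \<in> carrier A" "y1 \<in> carrier X" "y2 \<in> carrier X" for x a y1 y2 b1 b2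
    using that L by (simp add: Ypow_abelian_extension assms Ypow_fixed)
  have "satisfies_S k (abelian_extension X A \<phi>) \<longleftrightarrow>
      (\<forall>x\<in>carrier X. \<forall>a\<in>carrier A. \<forall>y1\<in>carrier X. \<forall>b1\<in>carrier A. \<forall>y2\<in>carrier X. \<forall>b2\<in>carrier A.
        eval_2chain A \<phi> (L_S k X x y1 y2) = \<one>\<^bsub>A\<^esub>)"
    unfolding satisfies_S_def carrier by (simp add: fixed_iff)
  then show ?thesis
    using A.one_closed by blast
qed

end

theorem corollary4p8:
  fixes X :: "('a, 'r) rack_struct_scheme" and k :: nat
  assumes "k > 1" and "quandle X" and "satisfies_S k X"
  shows "(\<forall>x\<in>carrier X. \<forall>y1\<in>carrier X. \<forall>y2\<in>carrier X. rack_cycle X 2 (L_S k X x y1 y2))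
    \<and> (\<forall>(A :: ('b, 's) monoid_scheme) \<phi>. comm_group A \<longrightarrow> rack_2cocycle X A \<phi> \<longrightarrow>
        (satisfies_S k (abelian_extension X A \<phi>) \<longleftrightarrow>
         (\<forall>x\<in>carrier X. \<forall>y1\<in>carrier X. \<forall>y2\<in>carrier X.
            eval_2chain A \<phi> (L_S k X x y1 y2) = \<one>\<^bsub>A\<^esub>)))
    \<and> rack_subcomplex X (S_chain_group k X)"
proof -
  interpret quandle X by fact
  show ?thesis
    unfolding rack_subcomplex_def image_subset_iff
    by (intro conjI allI impI ballI rack_cycle_L_S satisfies_S_abelian_extension_iff
        subgroup_S_chain_group boundary_S_chain_group assms)
qed

end
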